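(* Let $T>0$ and, for $N\in\mathbb{N}$, $N\ge 1$, let $\Delta t=T/N$. For each such $\Delta t$ let $G=G(\Delta t)$ be a square matrix of fixed size (independent of $\Delta t$) and let $\bm\theta_0,\dots,\bm\theta_{N-1}$ and $\bm e_0,\dots,\bm e_N$ be vectors (depending on $\Delta t$) with $$\bm e_{n+1}=G\,\bm e_n+\bm\theta_n,\qquad n=0,\dots,N-1 .$$ Let $G=WDW^{-1}$ be the eigen-decomposition of $G$, with $D$ the diagonal matrix whose entries are the eigenvalues of $G$ (so $W=W(\Delta t)$, $D=D(\Delta t)$), and assume that the spectral radius of $G$ satisfies $\rho(G)\le 1$. If $\bm e_0=\bm 0$, $W=O(\Delta t^q)$ and $W^{-1}\bm\theta_n=O(\Delta t^p)$ for some $q,p\in\mathbb{N}$, then $\bm e_n=O(\Delta t^{q+p-1})$.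
   Context: All $O(\cdot)$ statements are for $\Delta t\to 0$ (i.e. $N\to\infty$ with $T$ fixed), measured in the Euclidean vector norm and the induced $\ell^2$ matrix norm, with constants independent of $\Delta t$ and of the index $n$. In the paper's application, $\bm u_{n+1}=G\bm u_n$ is a one-step scheme, $\bm u_n^{ex}$ is the vector of exact solution values at the nodes of the $n$-th time slab, $\bm e_n=\bm u_n^{ex}-\bm u_n$ is the error and $\bm\theta_n=\bm u_{n+1}^{ex}-G\bm u_n^{ex}$ is the truncation error. *)

theory Defs
  imports "HOL-Analysis.Analysis" "HOL-Library.Landau_Symbols"
begin

definition eigenvalues :: "complex ^ 'm ^ 'm \<Rightarrow> complex set" where
  "eigenvalues A = {c. \<exists>v. v \<noteq> 0 \<and> A *v v = c *s v}"

definition spectral_radius :: "complex ^ 'm ^ 'm \<Rightarrow> real" where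
  "spectral_radius A = Max (norm ` eigenvalues A)"

definition diagonal_matrix :: "complex ^ 'm ^ 'm \<Rightarrow> bool" where
  "diagonal_matrix A \<longleftrightarrow> (\<forall>i j. i \<noteq> j \<longrightarrow> A $ i $ j = 0)"

text \<open>That the diagonal entries of \<open>D\<close> are the eigenvalues of \<open>A\<close> need not be
  required separately; see \<open>eigen_decomposition_eigenvalues\<close> below.\<close>

definition eigen_decomposition ::
  "complex ^ 'm ^ 'm \<Rightarrow> complex ^ 'm ^ 'm \<Rightarrow> complex ^ 'm ^ 'm \<Rightarrow> bool" where
  "eigen_decomposition A W D \<longleftrightarrow>
     invertible W \<and> diagonal_matrix D \<and> A = W ** D ** matrix_inv W"

text \<open>The operator norm induced by the Euclidean norm on \<open>complex ^ 'm\<close>.\<close>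

definition matrix_norm :: "complex ^ 'm ^ 'm \<Rightarrow> real" where
  "matrix_norm A = onorm ((*v) A)"

text \<open>\<open>f N i = O(g N)\<close> as \<open>N\<close> tends to infinity, with one constant and one threshold
  for all indices \<open>i \<in> I N\<close>.\<close>

definition uniform_bigo ::
  "(nat \<Rightarrow> 'i set) \<Rightarrow> (nat \<Rightarrow> 'i \<Rightarrow> 'a::real_normed_vector) \<Rightarrow> (nat \<Rightarrow> real) \<Rightarrow> bool" where
  "uniform_bigo I f g \<longleftrightarrow>
     (\<exists>C. eventually (\<lambda>N. \<forall>i \<in> I N. norm (f N i) \<le> C * \<bar>g N\<bar>) sequentially)"

lemma diagonal_matrix_mult_vec:
  assumes "diagonal_matrix D"
  shows "(D *v x) $ i = D $ i $ i * x $ i"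
proof -
  have "(D *v x) $ i = (\<Sum>j\<in>UNIV. D $ i $ j * x $ j)"
    by (simp add: matrix_vector_mult_def)
  also have "\<dots> = (\<Sum>j\<in>{i}. D $ i $ j * x $ j)"
    using assms by (intro sum.mono_neutral_right) (auto simp: diagonal_matrix_def)
  finally show ?thesis by simp
qed

lemma matrix_inv_mult:
  assumes "invertible (A :: complex ^ 'm ^ 'm)"
  shows "A ** matrix_inv A = mat 1" "matrix_inv A ** A = mat 1"
  using someI_ex[OF assms[unfolded invertible_def]] by (simp_all add: matrix_inv_def)

lemma eigen_decomposition_eigenvalues:
  assumes "eigen_decomposition A W D"
  shows "eigenvalues A = range (\<lambda>i. D $ i $ i)"
proof -
  have diag: "diagonal_matrix D" and A: "A = W ** D ** matrix_inv W"
    and inv: "W ** matrix_inv W = mat 1" "matrix_inv W ** W = mat 1"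
    using assms by (simp_all add: eigen_decomposition_def matrix_inv_mult)
  have "c \<in> range (\<lambda>i. D $ i $ i)" if "v \<noteq> 0" "A *v v = c *s v" for c v
  proof -
    define w where "w = matrix_inv W *v v"
    have v: "W *v w = v"
      by (simp add: w_def matrix_vector_mul_assoc inv)
    have "matrix_inv W *v (A *v v) = D *v w"
      by (simp add: A w_def matrix_vector_mul_assoc matrix_mul_assoc inv)
    then have eq: "D *v w = c *s w"
      using that by (simp add: w_def vector_scalar_commute)
    have "w \<noteq> 0" using v \<open>v \<noteq> 0\<close> by auto
    then obtain i where "w $ i \<noteq> 0" by (auto simp: vec_eq_iff)
    moreover have "D $ i $ i * w $ i = c * w $ i"
      using arg_cong[OF eq, of "\<lambda>u. u $ i"] by (simp only: diagonal_matrix_mult_vec[OF diag] vector_smult_component)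
    ultimately have "c = D $ i $ i" by simp
    then show ?thesis by simp
  qed
  moreover have "D $ i $ i \<in> eigenvalues A" for i
  proof -
    have "D *v axis i 1 = (D $ i $ i) *s axis i 1"
      by (auto simp: vec_eq_iff diagonal_matrix_mult_vec[OF diag] axis_def)
    moreover have "A *v (W *v axis i 1) = W *v (D *v axis i 1)"
      by (simp add: A matrix_vector_mul_assoc matrix_mul_assoc[symmetric] inv)
    ultimately have "A *v (W *v axis i 1) = (D $ i $ i) *s (W *v axis i 1)"
      by (simp add: vector_scalar_commute)
    moreover have "matrix_inv W *v (W *v axis i 1) = axis i (1::complex)"
      by (simp add: matrix_vector_mul_assoc inv)
    then have "W *v axis i 1 \<noteq> 0"
      by (metis axis_eq_0_iff matrix_vector_mult_0_right zero_neq_one)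
    ultimately show ?thesis by (auto simp: eigenvalues_def)
  qed
  ultimately show ?thesis by (auto simp: eigenvalues_def)
qed

end

theory Submission
  imports Defs
begin

text \<open>
  In the eigenvector coordinates \<open>y\<^sub>n = W\<^sup>-\<^sup>1 e\<^sub>n\<close> the recurrence becomes
  \<open>y\<^sub>n\<^sub>+\<^sub>1 = D y\<^sub>n + W\<^sup>-\<^sup>1 \<theta>\<^sub>n\<close>. Since \<open>\<rho>(G) \<le> 1\<close>, the diagonal matrix \<open>D\<close> does not
  increase the Euclidean norm, so the truncation errors merely add up:
  \<open>\<parallel>y\<^sub>n\<parallel> \<le> n C \<Delta>t\<^sup>p \<le> N C \<Delta>t\<^sup>p\<close>. The factor \<open>N = T / \<Delta>t\<close> costs one power of \<open>\<Delta>t\<close>, and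
  going back by \<open>e\<^sub>n = W y\<^sub>n\<close> gains the factor \<open>\<Delta>t\<^sup>q\<close>. Working in these coordinates is what
  avoids the condition number of \<open>W\<close>, and powers of \<open>G\<close> altogether: the bound on the product
  \<open>W\<^sup>-\<^sup>1 \<theta>\<^sub>n\<close> is used directly, and \<open>W\<close> is applied only once.
\<close>

text \<open>Real linearity suffices for \<open>matrix_norm\<close> to be a genuine operator norm.\<close>

lemma norm_matrix_vector_mult_le:
  fixes A :: "complex ^ 'm ^ 'm"
  shows "norm (A *v x) \<le> matrix_norm A * norm x"
proof -
  have "linear ((*v) A)"
    by (rule linearI)
      (simp_all add: vec_eq_iff matrix_vector_mult_def algebra_simps sum.distrib scaleR_sum_right)
  then show ?thesis
    unfolding matrix_norm_def by (simp add: onorm linear_conv_bounded_linear)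
qed

lemma norm_diagonal_matrix_mult_le:
  assumes "diagonal_matrix D" and "\<And>i. norm (D $ i $ i) \<le> 1"
  shows "norm (D *v x) \<le> norm x"
proof (rule norm_le_componentwise_cart)
  fix i
  show "norm ((D *v x) $ i) \<le> norm (x $ i)"
    using mult_right_mono[OF assms(2)[of i] norm_ge_zero[of "x $ i"]]
    by (simp add: diagonal_matrix_mult_vec[OF assms(1)] norm_mult)
qed

lemma norm_diagonal_entry_le_spectral_radius:
  assumes "eigen_decomposition A W D"
  shows "norm (D $ i $ i) \<le> spectral_radius A"
  unfolding spectral_radius_def eigen_decomposition_eigenvalues[OF assms]
  by (intro Max_ge) auto

lemma eigen_decomposition_inv_mult:
  assumes "eigen_decomposition A W D"
  shows "matrix_inv W *v (A *v x) = D *v (matrix_inv W *v x)"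
  using assms
  by (simp add: eigen_decomposition_def matrix_vector_mul_assoc matrix_mul_assoc matrix_inv_mult)

text \<open>A perturbation of size \<open>c\<close> per step can only accumulate linearly, because multiplication by
  \<open>D\<close> never amplifies what has accumulated so far.\<close>

lemma norm_eigen_coordinates_le:
  fixes A W D :: "complex ^ 'm ^ 'm" and e \<theta> :: "nat \<Rightarrow> complex ^ 'm"
  assumes decomp: "eigen_decomposition A W D"
    and radius: "spectral_radius A \<le> 1"
    and init: "e 0 = 0"
    and step: "\<And>n. n < N \<Longrightarrow> e (Suc n) = A *v e n + \<theta> n"
    and bound: "\<And>n. n < N \<Longrightarrow> norm (matrix_inv W *v \<theta> n) \<le> c"
    and "n \<le> N"
  shows "norm (matrix_inv W *v e n) \<le> real n * c"
  using \<open>n \<le> N\<close>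
proof (induction n)
  case 0
  then show ?case by (simp add: init)
next
  case (Suc n)
  have contract: "norm (D *v y) \<le> norm y" for y
  proof (rule norm_diagonal_matrix_mult_le)
    show "diagonal_matrix D"
      using decomp by (simp add: eigen_decomposition_def)
    show "norm (D $ i $ i) \<le> 1" for i
      using norm_diagonal_entry_le_spectral_radius[OF decomp] radius by (rule order_trans)
  qed
  have "matrix_inv W *v e (Suc n) = D *v (matrix_inv W *v e n) + matrix_inv W *v \<theta> n"
    using Suc.prems
    by (simp add: step matrix_vector_right_distrib eigen_decomposition_inv_mult[OF decomp])
  then have "norm (matrix_inv W *v e (Suc n))
      \<le> norm (D *v (matrix_inv W *v e n)) + norm (matrix_inv W *v \<theta> n)"
    by (simp add: norm_triangle_ineq)
  also have "\<dots> \<le> real n * c + c"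
    using Suc.prems
    by (intro add_mono order_trans[OF contract Suc.IH] bound) simp_all
  finally show ?case by (simp add: algebra_simps)
qed

theorem lemma1:
  fixes T :: real
    and G W D :: "nat \<Rightarrow> complex ^ 'm ^ 'm"
    and e \<theta> :: "nat \<Rightarrow> nat \<Rightarrow> complex ^ 'm"
    and p q :: nat
  assumes "T > 0"
    and "\<And>N n. N \<ge> 1 \<Longrightarrow> n < N \<Longrightarrow> e N (Suc n) = G N *v e N n + \<theta> N n"
    and "\<And>N. N \<ge> 1 \<Longrightarrow> eigen_decomposition (G N) (W N) (D N)"
    and "\<And>N. N \<ge> 1 \<Longrightarrow> spectral_radius (G N) \<le> 1"
    and "\<And>N. N \<ge> 1 \<Longrightarrow> e N 0 = 0"
    and "(\<lambda>N. matrix_norm (W N)) \<in> O(\<lambda>N. (T / real N) ^ q)"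
    and "uniform_bigo (\<lambda>N. {..<N}) (\<lambda>N n. matrix_inv (W N) *v \<theta> N n) (\<lambda>N. (T / real N) ^ p)"
  shows "uniform_bigo (\<lambda>N. {..N}) e (\<lambda>N. (T / real N) powi (int q + int p - 1))"
proof -
  obtain K where K: "K > 0"
    "eventually (\<lambda>N. norm (matrix_norm (W N)) \<le> K * norm ((T / real N) ^ q)) sequentially"
    using assms(6) by (elim landau_o.bigE)
  obtain C where C: "eventually (\<lambda>N. \<forall>n\<in>{..<N}.
      norm (matrix_inv (W N) *v \<theta> N n) \<le> C * \<bar>(T / real N) ^ p\<bar>) sequentially"
    using assms(7) by (auto simp: uniform_bigo_def)
  have "\<forall>\<^sub>F N in sequentially. \<forall>n\<in>{..N}.
      norm (e N n) \<le> (K * C * T) * \<bar>(T / real N) powi (int q + int p - 1)\<bar>"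
    using K(2) C eventually_ge_at_top[of 1]
  proof eventually_elim
    case (elim N)
    define h where "h = T / real N"
    have "h > 0" and N_h: "real N = T / h"
      using assms(1) elim(3) by (simp_all add: h_def)
    have W_le: "matrix_norm (W N) \<le> K * h ^ q"
      using elim(1) \<open>h > 0\<close> by (simp add: h_def[symmetric])
    have \<theta>_le: "norm (matrix_inv (W N) *v \<theta> N n) \<le> C * h ^ p" if "n < N" for n
      using elim(2) that \<open>h > 0\<close> by (auto simp: h_def[symmetric])
    \<comment> \<open>The constant is not assumed nonnegative, but \<open>N \<ge> 1\<close> makes the index set nonempty.\<close>
    have "0 \<le> C * h ^ p"
      using \<theta>_le[of 0] elim(3) by (intro order_trans[OF norm_ge_zero]) auto
    show ?case
    proof
      fix n assume "n \<in> {..N}"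
      have "norm (matrix_inv (W N) *v e N n) \<le> real n * (C * h ^ p)"
        using \<open>n \<in> {..N}\<close> elim(3) assms(2-5) \<theta>_le
        by (intro norm_eigen_coordinates_le[where A = "G N" and D = "D N" and \<theta> = "\<theta> N" and N = N])
          auto
      also have "\<dots> \<le> T / h * (C * h ^ p)"
        using \<open>n \<in> {..N}\<close> \<open>0 \<le> C * h ^ p\<close> unfolding N_h[symmetric] by (intro mult_right_mono) auto
      finally have y_le: "norm (matrix_inv (W N) *v e N n) \<le> T / h * (C * h ^ p)" .
      have "e N n = W N *v (matrix_inv (W N) *v e N n)"
        using assms(3)[of N] elim(3)
        by (simp add: eigen_decomposition_def matrix_vector_mul_assoc matrix_inv_mult)
      then have "norm (e N n) \<le> matrix_norm (W N) * norm (matrix_inv (W N) *v e N n)"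
        using norm_matrix_vector_mult_le by metis
      also have "\<dots> \<le> (K * h ^ q) * (T / h * (C * h ^ p))"
        using W_le y_le K(1) \<open>h > 0\<close> by (intro mult_mono) auto
      also have "\<dots> = (K * C * T) * \<bar>h powi (int q + int p - 1)\<bar>"
        using \<open>h > 0\<close> by (simp add: power_int_diff power_int_add)
      finally show "norm (e N n) \<le> (K * C * T) * \<bar>(T / real N) powi (int q + int p - 1)\<bar>"
        by (simp add: h_def)
    qed
  qed
  then show ?thesis
    unfolding uniform_bigo_def by blast
qed

end
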